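(* Let $S$ be a right inverse ordered semigroup (without zero). The following are equivalent: (1) $\mathcal{R}$ is a congruence on $S$; (2) $\mathcal{L}=\mathcal{H}$ on $S$; (3) $S$ is a complete semilattice of right group like ordered semigroups.
   Context: An ordered semigroup $(S,\cdot,\leq)$ is a semigroup with a partial order such that $a\leq b$ implies $xa\leq xb$ and $ax\leq bx$ for all $x\in S$. Standing assumption: the ambient ordered semigroup $S$ has no zero element (an element $0$ with $0x=x0=0$ and $0\leq x$ for all $x\in S$). For $H\subseteq S$, $(H]=\{t\in S: t\leq h \text{ for some } h\in H\}$. For $a\in S$: $aS=\{as:s\in S\}$, $Sa=\{sa:s\in S\}$, $aSa=\{asa:s\in S\}$. $S$ is regular if $a\in (aSa]$ for every $a\in S$. A nonempty $I\subseteq S$ is a left (right) ideal if $SI\subseteq I$ ($IS\subseteq I$) and $(I]\subseteq I$. $L(a)$ and $R(a)$ denote the smallest left, respectively right, ideal containing $a$. Green's relations: $a\,\mathcal{L}\,b$ iff $L(a)=L(b)$; $a\,\mathcal{R}\,b$ iff $R(a)=R(b)$; $\mathcal{H}=\mathcal{L}\cap\mathcal{R}$. $E_{\leq}(S)=\{e\in S: e\leq e^2\}$ is the set of ordered idempotents. $S$ is right inverse if it is regular and every principal left ideal is generated by an $\mathcal{R}$-unique ordered idempotent, i.e. for every $a\in S$ there is $e\in E_{\leq}(S)$ with $L(a)=L(e)$, and any two $e,f\in E_{\leq}(S)$ with $L(e)=L(a)=L(f)$ satisfy $e\,\mathcal{R}\,f$. An ordered semigroup $T$ is right group like if it is regular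 and $a\in (bT]$ for all $a,b\in T$. A congruence is an equivalence relation $\rho$ such that $a\,\rho\,b$ implies $ca\,\rho\,cb$ and $ac\,\rho\,bc$ for all $c\in S$. A semilattice congruence is a congruence $\rho$ with $a\,\rho\,a^2$ and $ab\,\rho\,ba$ for all $a,b\in S$; it is complete if in addition $a\leq b$ implies $a\,\rho\,ab$. $S$ is a complete semilattice of right group like ordered semigroups if there is a complete semilattice congruence $\rho$ on $S$ such that every $\rho$-class, with the induced multiplication and order, is a right group like ordered semigroup (the no-zero assumption is imposed on $S$ only, not on the classes). *)

theory Defs
  imports Main
begin

locale ordered_semigroup =
  fixes S :: "'a set"
    and mult :: "'a \<Rightarrow> 'a \<Rightarrow> 'a"  (infixl \<open>\<cdot>\<close> 70)
    and le :: "'a \<Rightarrow> 'a \<Rightarrow> bool"  (infix \<open>\<preceq>\<close> 50)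
  assumes nonempty: "S \<noteq> {}"
    and closed: "\<lbrakk>a \<in> S; b \<in> S\<rbrakk> \<Longrightarrow> a \<cdot> b \<in> S"
    and assoc: "\<lbrakk>a \<in> S; b \<in> S; c \<in> S\<rbrakk> \<Longrightarrow> (a \<cdot> b) \<cdot> c = a \<cdot> (b \<cdot> c)"
    and refl_le: "reflp_on S (\<preceq>)"
    and antisym_le: "antisymp_on S (\<preceq>)"
    and trans_le: "transp_on S (\<preceq>)"
    and mono_left: "\<lbrakk>a \<in> S; b \<in> S; x \<in> S; a \<preceq> b\<rbrakk> \<Longrightarrow> x \<cdot> a \<preceq> x \<cdot> b"
    and mono_right: "\<lbrakk>a \<in> S; b \<in> S; x \<in> S; a \<preceq> b\<rbrakk> \<Longrightarrow> a \<cdot> x \<preceq> b \<cdot> x"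

text \<open>
  All notions below take the carrier, the multiplication and the order as explicit arguments, so
  that they apply to a subset of \<open>S\<close> with the induced structure simply by changing the carrier.
\<close>

definition has_zero :: "'a set \<Rightarrow> ('a \<Rightarrow> 'a \<Rightarrow> 'a) \<Rightarrow> ('a \<Rightarrow> 'a \<Rightarrow> bool) \<Rightarrow> bool" where
  "has_zero S mult le \<longleftrightarrow> (\<exists>z\<in>S. \<forall>x\<in>S. mult z x = z \<and> mult x z = z \<and> le z x)"

definition downset :: "'a set \<Rightarrow> ('a \<Rightarrow> 'a \<Rightarrow> bool) \<Rightarrow> 'a set \<Rightarrow> 'a set" where
  "downset S le H = {t \<in> S. \<exists>h\<in>H. le t h}"

definition regular :: "'a set \<Rightarrow> ('a \<Rightarrow> 'a \<Rightarrow> 'a) \<Rightarrow> ('a \<Rightarrow> 'a \<Rightarrow> bool) \<Rightarrow> bool" where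
  "regular S mult le \<longleftrightarrow> (\<forall>a\<in>S. a \<in> downset S le {mult (mult a s) a | s. s \<in> S})"

definition left_ideal ::
  "'a set \<Rightarrow> ('a \<Rightarrow> 'a \<Rightarrow> 'a) \<Rightarrow> ('a \<Rightarrow> 'a \<Rightarrow> bool) \<Rightarrow> 'a set \<Rightarrow> bool" where
  "left_ideal S mult le I \<longleftrightarrow>
     I \<noteq> {} \<and> I \<subseteq> S \<and> {mult s i | s i. s \<in> S \<and> i \<in> I} \<subseteq> I \<and> downset S le I \<subseteq> I"

definition right_ideal ::
  "'a set \<Rightarrow> ('a \<Rightarrow> 'a \<Rightarrow> 'a) \<Rightarrow> ('a \<Rightarrow> 'a \<Rightarrow> bool) \<Rightarrow> 'a set \<Rightarrow> bool" where
  "right_ideal S mult le I \<longleftrightarrow>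
     I \<noteq> {} \<and> I \<subseteq> S \<and> {mult i s | i s. i \<in> I \<and> s \<in> S} \<subseteq> I \<and> downset S le I \<subseteq> I"

text \<open>
  The smallest left (right) ideal containing an element is taken to be the intersection of all of
  them; \<open>left_ideal_principal\<close> and \<open>right_ideal_principal\<close> confirm that it is itself such an ideal.
\<close>

definition principal_left ::
  "'a set \<Rightarrow> ('a \<Rightarrow> 'a \<Rightarrow> 'a) \<Rightarrow> ('a \<Rightarrow> 'a \<Rightarrow> bool) \<Rightarrow> 'a \<Rightarrow> 'a set" where
  "principal_left S mult le a = \<Inter>{I. left_ideal S mult le I \<and> a \<in> I}"

definition principal_right ::
  "'a set \<Rightarrow> ('a \<Rightarrow> 'a \<Rightarrow> 'a) \<Rightarrow> ('a \<Rightarrow> 'a \<Rightarrow> bool) \<Rightarrow> 'a \<Rightarrow> 'a set" where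
  "principal_right S mult le a = \<Inter>{I. right_ideal S mult le I \<and> a \<in> I}"

lemma (in ordered_semigroup) left_ideal_principal:
  assumes "a \<in> S"
  shows "left_ideal S (\<cdot>) (\<preceq>) (principal_left S (\<cdot>) (\<preceq>) a)"
    and "a \<in> principal_left S (\<cdot>) (\<preceq>) a"
proof -
  have S: "left_ideal S (\<cdot>) (\<preceq>) S"
    using nonempty closed by (auto simp: left_ideal_def downset_def)
  let ?P = "principal_left S (\<cdot>) (\<preceq>) a"
  have sub: "?P \<subseteq> J" if "left_ideal S (\<cdot>) (\<preceq>) J" "a \<in> J" for J
    using that unfolding principal_left_def by (intro Inter_lower CollectI conjI)
  have memI: "x \<in> ?P" if "\<And>J. left_ideal S (\<cdot>) (\<preceq>) J \<Longrightarrow> a \<in> J \<Longrightarrow> x \<in> J" for x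
    using that by (simp add: principal_left_def)
  show a: "a \<in> ?P"
    by (rule memI)
  have mul: "s \<cdot> i \<in> ?P" if "s \<in> S" "i \<in> ?P" for s i
  proof (rule memI)
    fix J assume J: "left_ideal S (\<cdot>) (\<preceq>) J" "a \<in> J"
    then have "i \<in> J" using sub that(2) by blast
    with J(1) that(1) show "s \<cdot> i \<in> J" unfolding left_ideal_def by blast
  qed
  have down: "t \<in> ?P" if "t \<in> S" "i \<in> ?P" "t \<preceq> i" for t i
  proof (rule memI)
    fix J assume J: "left_ideal S (\<cdot>) (\<preceq>) J" "a \<in> J"
    then have "i \<in> J" using sub that(2) by blast
    with that(1,3) have "t \<in> downset S (\<preceq>) J" unfolding downset_def by blast
    with J(1) show "t \<in> J" unfolding left_ideal_def by blast
  qed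
  show "left_ideal S (\<cdot>) (\<preceq>) ?P"
    unfolding left_ideal_def
  proof (intro conjI)
    show "?P \<noteq> {}" using a by blast
    show "?P \<subseteq> S" using S assms by (rule sub)
    show "{s \<cdot> i | s i. s \<in> S \<and> i \<in> ?P} \<subseteq> ?P" using mul by blast
    show "downset S (\<preceq>) ?P \<subseteq> ?P" using down unfolding downset_def by blast
  qed
qed

lemma (in ordered_semigroup) right_ideal_principal:
  assumes "a \<in> S"
  shows "right_ideal S (\<cdot>) (\<preceq>) (principal_right S (\<cdot>) (\<preceq>) a)"
    and "a \<in> principal_right S (\<cdot>) (\<preceq>) a"
proof -
  have S: "right_ideal S (\<cdot>) (\<preceq>) S"
    using nonempty closed by (auto simp: right_ideal_def downset_def)
  let ?P = "principal_right S (\<cdot>) (\<preceq>) a"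
  have sub: "?P \<subseteq> J" if "right_ideal S (\<cdot>) (\<preceq>) J" "a \<in> J" for J
    using that unfolding principal_right_def by (intro Inter_lower CollectI conjI)
  have memI: "x \<in> ?P" if "\<And>J. right_ideal S (\<cdot>) (\<preceq>) J \<Longrightarrow> a \<in> J \<Longrightarrow> x \<in> J" for x
    using that by (simp add: principal_right_def)
  show a: "a \<in> ?P"
    by (rule memI)
  have mul: "i \<cdot> s \<in> ?P" if "s \<in> S" "i \<in> ?P" for s i
  proof (rule memI)
    fix J assume J: "right_ideal S (\<cdot>) (\<preceq>) J" "a \<in> J"
    then have "i \<in> J" using sub that(2) by blast
    with J(1) that(1) show "i \<cdot> s \<in> J" unfolding right_ideal_def by blast
  qed
  have down: "t \<in> ?P" if "t \<in> S" "i \<in> ?P" "t \<preceq> i" for t i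
  proof (rule memI)
    fix J assume J: "right_ideal S (\<cdot>) (\<preceq>) J" "a \<in> J"
    then have "i \<in> J" using sub that(2) by blast
    with that(1,3) have "t \<in> downset S (\<preceq>) J" unfolding downset_def by blast
    with J(1) show "t \<in> J" unfolding right_ideal_def by blast
  qed
  show "right_ideal S (\<cdot>) (\<preceq>) ?P"
    unfolding right_ideal_def
  proof (intro conjI)
    show "?P \<noteq> {}" using a by blast
    show "?P \<subseteq> S" using S assms by (rule sub)
    show "{i \<cdot> s | i s. i \<in> ?P \<and> s \<in> S} \<subseteq> ?P" using mul by blast
    show "downset S (\<preceq>) ?P \<subseteq> ?P" using down unfolding downset_def by blast
  qed
qed

definition green_L ::
  "'a set \<Rightarrow> ('a \<Rightarrow> 'a \<Rightarrow> 'a) \<Rightarrow> ('a \<Rightarrow> 'a \<Rightarrow> bool) \<Rightarrow> 'a rel" where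
  "green_L S mult le =
     {(a, b). a \<in> S \<and> b \<in> S \<and> principal_left S mult le a = principal_left S mult le b}"

definition green_R ::
  "'a set \<Rightarrow> ('a \<Rightarrow> 'a \<Rightarrow> 'a) \<Rightarrow> ('a \<Rightarrow> 'a \<Rightarrow> bool) \<Rightarrow> 'a rel" where
  "green_R S mult le =
     {(a, b). a \<in> S \<and> b \<in> S \<and> principal_right S mult le a = principal_right S mult le b}"

definition green_H ::
  "'a set \<Rightarrow> ('a \<Rightarrow> 'a \<Rightarrow> 'a) \<Rightarrow> ('a \<Rightarrow> 'a \<Rightarrow> bool) \<Rightarrow> 'a rel" where
  "green_H S mult le = green_L S mult le \<inter> green_R S mult le"

definition ordered_idempotents ::
  "'a set \<Rightarrow> ('a \<Rightarrow> 'a \<Rightarrow> 'a) \<Rightarrow> ('a \<Rightarrow> 'a \<Rightarrow> bool) \<Rightarrow> 'a set" where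
  "ordered_idempotents S mult le = {e \<in> S. le e (mult e e)}"

locale right_inverse_ordered_semigroup = ordered_semigroup +
  assumes regular: "regular S (\<cdot>) (\<preceq>)"
    and generator_exists:
      "a \<in> S \<Longrightarrow> \<exists>e\<in>ordered_idempotents S (\<cdot>) (\<preceq>).
         principal_left S (\<cdot>) (\<preceq>) a = principal_left S (\<cdot>) (\<preceq>) e"
    and generator_R_unique:
      "\<lbrakk>a \<in> S; e \<in> ordered_idempotents S (\<cdot>) (\<preceq>); f \<in> ordered_idempotents S (\<cdot>) (\<preceq>);
        principal_left S (\<cdot>) (\<preceq>) e = principal_left S (\<cdot>) (\<preceq>) a;
        principal_left S (\<cdot>) (\<preceq>) a = principal_left S (\<cdot>) (\<preceq>) f\<rbrakk>
       \<Longrightarrow> (e, f) \<in> green_R S (\<cdot>) (\<preceq>)"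

locale right_group_like = ordered_semigroup +
  assumes regular: "regular S (\<cdot>) (\<preceq>)"
    and right_simple: "\<lbrakk>a \<in> S; b \<in> S\<rbrakk> \<Longrightarrow> a \<in> downset S (\<preceq>) {b \<cdot> s | s. s \<in> S}"

definition congruence :: "'a set \<Rightarrow> ('a \<Rightarrow> 'a \<Rightarrow> 'a) \<Rightarrow> 'a rel \<Rightarrow> bool" where
  "congruence S mult \<rho> \<longleftrightarrow>
     equiv S \<rho> \<and>
     (\<forall>(a, b)\<in>\<rho>. \<forall>c\<in>S. (mult c a, mult c b) \<in> \<rho> \<and> (mult a c, mult b c) \<in> \<rho>)"

definition semilattice_congruence :: "'a set \<Rightarrow> ('a \<Rightarrow> 'a \<Rightarrow> 'a) \<Rightarrow> 'a rel \<Rightarrow> bool" where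
  "semilattice_congruence S mult \<rho> \<longleftrightarrow>
     congruence S mult \<rho> \<and>
     (\<forall>a\<in>S. (a, mult a a) \<in> \<rho>) \<and>
     (\<forall>a\<in>S. \<forall>b\<in>S. (mult a b, mult b a) \<in> \<rho>)"

definition complete_semilattice_congruence ::
  "'a set \<Rightarrow> ('a \<Rightarrow> 'a \<Rightarrow> 'a) \<Rightarrow> ('a \<Rightarrow> 'a \<Rightarrow> bool) \<Rightarrow> 'a rel \<Rightarrow> bool" where
  "complete_semilattice_congruence S mult le \<rho> \<longleftrightarrow>
     semilattice_congruence S mult \<rho> \<and>
     (\<forall>a\<in>S. \<forall>b\<in>S. le a b \<longrightarrow> (a, mult a b) \<in> \<rho>)"

definition complete_semilattice_of_right_group_like ::
  "'a set \<Rightarrow> ('a \<Rightarrow> 'a \<Rightarrow> 'a) \<Rightarrow> ('a \<Rightarrow> 'a \<Rightarrow> bool) \<Rightarrow> bool" where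
  "complete_semilattice_of_right_group_like S mult le \<longleftrightarrow>
     (\<exists>\<rho>. complete_semilattice_congruence S mult le \<rho> \<and>
          (\<forall>T\<in>S // \<rho>. right_group_like T mult le))"

end

theory Submission
  imports Defs
begin

text \<open>
  In a regular ordered semigroup, Green's relations are the equivalences of the preorders
  \<open>a \<in> (bS]\<close> and \<open>a \<in> (Sb]\<close>.

  If \<open>\<L> \<subseteq> \<R>\<close>, then \<open>xa \<le> xatxa\<close> gives \<open>xa \<L> atxa\<close>, so \<open>xa \<in> (aS]\<close>: right ideals are two-sided.
  This makes \<open>\<R>\<close> itself a complete semilattice congruence with right group like classes.
  Conversely, \<open>\<L>\<close>-related elements lie in the same class of every complete semilattice congruence,
  and right simplicity of the classes makes them \<open>\<R>\<close>-related.

  In a right inverse \<open>S\<close>, ordered idempotents satisfy \<open>fe \<in> (eS]\<close>. When \<open>\<R>\<close> is a congruence, every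
  \<open>a\<close> is \<open>\<R>\<close>-related to its square, and applying the previous fact to \<open>as\<close> and \<open>sa\<close> for an inverse
  \<open>s\<close> of \<open>a\<close> yields \<open>a \<R> sa\<close>. As \<open>a \<L> sa\<close> with \<open>sa\<close> an ordered idempotent, \<open>\<L> \<subseteq> \<R>\<close> follows
  from the \<open>\<R>\<close>-uniqueness of idempotent generators.
\<close>

section \<open>The preorders of right and left divisibility up to the order\<close>

context ordered_semigroup
begin

lemma le_refl: "a \<in> S \<Longrightarrow> a \<preceq> a"
  using refl_le by (rule reflp_onD)

lemma le_trans: "\<lbrakk>a \<preceq> b; b \<preceq> c; a \<in> S; b \<in> S; c \<in> S\<rbrakk> \<Longrightarrow> a \<preceq> c"
  using trans_le by (blast dest: transp_onD)

lemma mult_mono: "\<lbrakk>a \<preceq> b; c \<preceq> d; a \<in> S; b \<in> S; c \<in> S; d \<in> S\<rbrakk> \<Longrightarrow> a \<cdot> c \<preceq> b \<cdot> d"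
  by (rule le_trans[OF mono_right mono_left]) (simp_all add: closed)

text \<open>This is membership in (bS], without the summand b that a principal right ideal has in
  general, so reflexivity has to wait for regularity. Carrier membership is built in so that chains
  of comparisons carry no side conditions.\<close>

definition le_R :: "'a \<Rightarrow> 'a \<Rightarrow> bool"  (infix \<open>\<preceq>\<^sub>R\<close> 50) where
  "a \<preceq>\<^sub>R b \<longleftrightarrow> a \<in> S \<and> b \<in> S \<and> (\<exists>x\<in>S. a \<preceq> b \<cdot> x)"

definition le_L :: "'a \<Rightarrow> 'a \<Rightarrow> bool"  (infix \<open>\<preceq>\<^sub>L\<close> 50) where
  "a \<preceq>\<^sub>L b \<longleftrightarrow> a \<in> S \<and> b \<in> S \<and> (\<exists>x\<in>S. a \<preceq> x \<cdot> b)"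

lemma le_RD: "a \<preceq>\<^sub>R b \<Longrightarrow> a \<in> S \<and> b \<in> S"
  unfolding le_R_def by blast

lemma le_RI: "\<lbrakk>a \<preceq> b \<cdot> x; a \<in> S; b \<in> S; x \<in> S\<rbrakk> \<Longrightarrow> a \<preceq>\<^sub>R b"
  unfolding le_R_def by blast

lemma le_LD: "a \<preceq>\<^sub>L b \<Longrightarrow> a \<in> S \<and> b \<in> S"
  unfolding le_L_def by blast

lemma le_LI: "\<lbrakk>a \<preceq> x \<cdot> b; a \<in> S; b \<in> S; x \<in> S\<rbrakk> \<Longrightarrow> a \<preceq>\<^sub>L b"
  unfolding le_L_def by blast

lemma le_R_trans [trans]:
  assumes "a \<preceq>\<^sub>R b" "b \<preceq>\<^sub>R c"
  shows "a \<preceq>\<^sub>R c"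
proof -
  obtain x y where xy: "x \<in> S" "y \<in> S" "a \<preceq> b \<cdot> x" "b \<preceq> c \<cdot> y"
    and abc: "a \<in> S" "b \<in> S" "c \<in> S"
    using assms unfolding le_R_def by blast
  have "b \<cdot> x \<preceq> c \<cdot> (y \<cdot> x)"
    using mono_right[OF _ _ _ xy(4), of x] xy abc by (simp add: assoc closed)
  then have "a \<preceq> c \<cdot> (y \<cdot> x)"
    by (rule le_trans[OF xy(3)]) (use xy abc in \<open>simp_all add: closed\<close>)
  then show ?thesis
    by (rule le_RI) (use xy abc in \<open>simp_all add: closed\<close>)
qed

lemma le_L_trans [trans]:
  assumes "a \<preceq>\<^sub>L b" "b \<preceq>\<^sub>L c"
  shows "a \<preceq>\<^sub>L c"
proof -
  obtain x y where xy: "x \<in> S" "y \<in> S" "a \<preceq> x \<cdot> b" "b \<preceq> y \<cdot> c"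
    and abc: "a \<in> S" "b \<in> S" "c \<in> S"
    using assms unfolding le_L_def by blast
  have "x \<cdot> b \<preceq> (x \<cdot> y) \<cdot> c"
    using mono_left[OF _ _ _ xy(4), of x] xy abc by (simp add: assoc closed)
  then have "a \<preceq> (x \<cdot> y) \<cdot> c"
    by (rule le_trans[OF xy(3)]) (use xy abc in \<open>simp_all add: closed\<close>)
  then show ?thesis
    by (rule le_LI) (use xy abc in \<open>simp_all add: closed\<close>)
qed

lemma le_R_mult_right: "\<lbrakk>a \<in> S; x \<in> S\<rbrakk> \<Longrightarrow> a \<cdot> x \<preceq>\<^sub>R a"
  by (intro le_RI[of _ _ x] le_refl closed)

lemma le_L_mult_left: "\<lbrakk>a \<in> S; x \<in> S\<rbrakk> \<Longrightarrow> x \<cdot> a \<preceq>\<^sub>L a"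
  by (intro le_LI[of _ x] le_refl closed)

text \<open>The multiplier x stands on the far right, out of the way of c. Hence only right
  multiplication is at stake when \<R> is asked to be a congruence.\<close>

lemma le_R_mult_left:
  assumes "a \<preceq>\<^sub>R b" "c \<in> S"
  shows "c \<cdot> a \<preceq>\<^sub>R c \<cdot> b"
proof -
  obtain x where x: "x \<in> S" "a \<preceq> b \<cdot> x" "a \<in> S" "b \<in> S"
    using assms(1) unfolding le_R_def by blast
  then have "c \<cdot> a \<preceq> c \<cdot> b \<cdot> x"
    using mono_left[of a "b \<cdot> x" c] assms(2) by (simp add: assoc closed)
  then show ?thesis
    by (rule le_RI) (use x assms(2) in \<open>simp_all add: closed\<close>)
qed

end

section \<open>Ordered inverses and Green's relations under regularity\<close>

locale regular_ordered_semigroup = ordered_semigroup +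
  assumes regularity: "regular S (\<cdot>) (\<preceq>)"
begin

text \<open>If t witnesses regularity of a, then s = tat satisfies both inequalities: substitute
  \<open>a \<preceq> a \<cdot> t \<cdot> a\<close> into itself, then multiply the result by t on
  both sides.\<close>

lemma inverse_exists:
  assumes "a \<in> S"
  obtains s where "s \<in> S" "a \<preceq> a \<cdot> s \<cdot> a" "s \<preceq> s \<cdot> a \<cdot> s"
proof -
  obtain t where t: "t \<in> S" "a \<preceq> a \<cdot> t \<cdot> a"
    using regularity assms unfolding regular_def downset_def by auto
  have cl: "t \<cdot> a \<cdot> t \<in> S" "a \<cdot> t \<in> S" "t \<cdot> a \<in> S" "a \<cdot> t \<cdot> a \<in> S"
    using assms t closed by auto
  have a1: "a \<cdot> t \<cdot> a \<preceq> a \<cdot> (t \<cdot> a \<cdot> t) \<cdot> a"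
    using mono_right[OF _ _ _ t(2), of "t \<cdot> a"] assms t cl by (simp add: assoc closed)
  have a2: "a \<preceq> a \<cdot> (t \<cdot> a \<cdot> t) \<cdot> a"
    using le_trans[OF t(2) a1] assms cl by (simp add: closed)
  have "t \<cdot> a \<cdot> t \<preceq> t \<cdot> (a \<cdot> (t \<cdot> a \<cdot> t) \<cdot> a) \<cdot> t"
    using a2 assms t cl by (intro mult_mono le_refl closed)
  then have "t \<cdot> a \<cdot> t \<preceq> (t \<cdot> a \<cdot> t) \<cdot> a \<cdot> (t \<cdot> a \<cdot> t)"
    using assms t by (simp add: assoc closed)
  with a2 cl(1) show thesis
    by (intro that)
qed

text \<open>Regularity of the larger element supplies the multiplier: b lies below b(sb). The case a
  = b gives reflexivity.\<close>

lemma le_R_if_le: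
  assumes "a \<preceq> b" "a \<in> S" "b \<in> S"
  shows "a \<preceq>\<^sub>R b"
proof -
  obtain s where s: "s \<in> S" "b \<preceq> b \<cdot> s \<cdot> b"
    using inverse_exists assms(3) by blast
  then have "a \<preceq> b \<cdot> (s \<cdot> b)"
    using le_trans[OF assms(1) s(2)] assms closed by (simp add: assoc)
  then show ?thesis
    by (rule le_RI) (use assms s in \<open>simp_all add: closed\<close>)
qed

lemma le_L_if_le:
  assumes "a \<preceq> b" "a \<in> S" "b \<in> S"
  shows "a \<preceq>\<^sub>L b"
proof -
  obtain s where s: "s \<in> S" "b \<preceq> b \<cdot> s \<cdot> b"
    using inverse_exists assms(3) by blast
  then have "a \<preceq> (b \<cdot> s) \<cdot> b"
    using le_trans[OF assms(1) s(2)] assms closed by simp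
  then show ?thesis
    by (rule le_LI) (use assms s in \<open>simp_all add: closed\<close>)
qed

lemma le_R_refl: "a \<in> S \<Longrightarrow> a \<preceq>\<^sub>R a"
  by (intro le_R_if_le le_refl)

lemma le_L_refl: "a \<in> S \<Longrightarrow> a \<preceq>\<^sub>L a"
  by (intro le_L_if_le le_refl)

text \<open>The set on the right is a right ideal, and by reflexivity it contains a. Conversely,
  every right ideal containing a contains aS and everything below it.\<close>

lemma principal_right_eq:
  assumes "a \<in> S"
  shows "principal_right S (\<cdot>) (\<preceq>) a = {t. t \<preceq>\<^sub>R a}"
proof
  have "right_ideal S (\<cdot>) (\<preceq>) {t. t \<preceq>\<^sub>R a}"
    unfolding right_ideal_def
  proof (intro conjI)
    show "{t. t \<preceq>\<^sub>R a} \<noteq> {}"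
      using le_R_refl[OF assms] by blast
    show "{t. t \<preceq>\<^sub>R a} \<subseteq> S"
      unfolding le_R_def by blast
    then show "{i \<cdot> s |i s. i \<in> {t. t \<preceq>\<^sub>R a} \<and> s \<in> S} \<subseteq> {t. t \<preceq>\<^sub>R a}"
      using le_R_trans le_R_mult_right by blast
    show "downset S (\<preceq>) {t. t \<preceq>\<^sub>R a} \<subseteq> {t. t \<preceq>\<^sub>R a}"
      using le_R_trans[OF le_R_if_le] le_RD unfolding downset_def by blast
  qed
  then show "principal_right S (\<cdot>) (\<preceq>) a \<subseteq> {t. t \<preceq>\<^sub>R a}"
    using le_R_refl[OF assms] unfolding principal_right_def by blast
  show "{t. t \<preceq>\<^sub>R a} \<subseteq> principal_right S (\<cdot>) (\<preceq>) a"
    using right_ideal_principal[OF assms] unfolding right_ideal_def le_R_def downset_def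
    by blast
qed

lemma principal_left_eq:
  assumes "a \<in> S"
  shows "principal_left S (\<cdot>) (\<preceq>) a = {t. t \<preceq>\<^sub>L a}"
proof
  have "left_ideal S (\<cdot>) (\<preceq>) {t. t \<preceq>\<^sub>L a}"
    unfolding left_ideal_def
  proof (intro conjI)
    show "{t. t \<preceq>\<^sub>L a} \<noteq> {}"
      using le_L_refl[OF assms] by blast
    show "{t. t \<preceq>\<^sub>L a} \<subseteq> S"
      unfolding le_L_def by blast
    then show "{s \<cdot> i |s i. s \<in> S \<and> i \<in> {t. t \<preceq>\<^sub>L a}} \<subseteq> {t. t \<preceq>\<^sub>L a}"
      using le_L_trans le_L_mult_left by blast
    show "downset S (\<preceq>) {t. t \<preceq>\<^sub>L a} \<subseteq> {t. t \<preceq>\<^sub>L a}"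
      using le_L_trans[OF le_L_if_le] le_LD unfolding downset_def by blast
  qed
  then show "principal_left S (\<cdot>) (\<preceq>) a \<subseteq> {t. t \<preceq>\<^sub>L a}"
    using le_L_refl[OF assms] unfolding principal_left_def by blast
  show "{t. t \<preceq>\<^sub>L a} \<subseteq> principal_left S (\<cdot>) (\<preceq>) a"
    using left_ideal_principal[OF assms] unfolding left_ideal_def le_L_def downset_def
    by blast
qed

abbreviation R_rel :: "'a rel"  (\<open>\<R>\<close>) where
  "\<R> \<equiv> green_R S (\<cdot>) (\<preceq>)"

abbreviation L_rel :: "'a rel"  (\<open>\<L>\<close>) where
  "\<L> \<equiv> green_L S (\<cdot>) (\<preceq>)"

lemma green_R_iff: "(a, b) \<in> \<R> \<longleftrightarrow> a \<preceq>\<^sub>R b \<and> b \<preceq>\<^sub>R a"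
proof (cases "a \<in> S \<and> b \<in> S")
  case True
  then have "(a, b) \<in> \<R> \<longleftrightarrow> {t. t \<preceq>\<^sub>R a} = {t. t \<preceq>\<^sub>R b}"
    by (simp add: green_R_def principal_right_eq)
  then show ?thesis
    using True le_R_refl le_R_trans by blast
qed (auto simp: green_R_def le_R_def)

lemma green_L_iff: "(a, b) \<in> \<L> \<longleftrightarrow> a \<preceq>\<^sub>L b \<and> b \<preceq>\<^sub>L a"
proof (cases "a \<in> S \<and> b \<in> S")
  case True
  then have "(a, b) \<in> \<L> \<longleftrightarrow> {t. t \<preceq>\<^sub>L a} = {t. t \<preceq>\<^sub>L b}"
    by (simp add: green_L_def principal_left_eq)
  then show ?thesis
    using True le_L_refl le_L_trans by blast
qed (auto simp: green_L_def le_L_def)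

lemma green_L_eq_green_H_iff: "\<L> = green_H S (\<cdot>) (\<preceq>) \<longleftrightarrow> \<L> \<subseteq> \<R>"
  unfolding green_H_def by blast

lemma equiv_green_R: "equiv S \<R>"
  unfolding green_R_def equiv_def refl_on_def sym_def trans_def by auto

lemma le_R_mult_self_if_L_subset_R:
  assumes "\<L> \<subseteq> \<R>" "a \<in> S" "x \<in> S"
  shows "x \<cdot> a \<preceq>\<^sub>R a"
proof -
  \<comment> \<open>Regularity is applied to xa, not to a, so that the bound xatxa is a left
    multiple of an element beginning with a and ending in xa.\<close>
  obtain t where t: "t \<in> S" "x \<cdot> a \<preceq> x \<cdot> a \<cdot> t \<cdot> (x \<cdot> a)"
    using inverse_exists[OF closed[OF assms(3,2)]] by blast
  have "x \<cdot> a \<preceq> x \<cdot> (a \<cdot> (t \<cdot> (x \<cdot> a)))"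
    using t assms by (simp add: assoc closed)
  then have "x \<cdot> a \<preceq>\<^sub>L a \<cdot> (t \<cdot> (x \<cdot> a))"
    by (rule le_LI) (use assms t in \<open>simp_all add: closed\<close>)
  moreover have "a \<cdot> (t \<cdot> (x \<cdot> a)) \<preceq>\<^sub>L x \<cdot> a"
    using le_L_mult_left[of "x \<cdot> a" "a \<cdot> t"] assms t by (simp add: assoc closed)
  ultimately have "x \<cdot> a \<preceq>\<^sub>R a \<cdot> (t \<cdot> (x \<cdot> a))"
    using assms(1) green_L_iff green_R_iff by blast
  also have "\<dots> \<preceq>\<^sub>R a"
    using assms t by (intro le_R_mult_right closed)
  finally show ?thesis .
qed

end

section \<open>The right duo case: every right ideal is two-sided\<close>

locale right_duo_ordered_semigroup = regular_ordered_semigroup +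
  assumes duo: "\<lbrakk>a \<in> S; x \<in> S\<rbrakk> \<Longrightarrow> x \<cdot> a \<preceq>\<^sub>R a"
begin

lemma le_R_mult_right_cong:
  assumes "a \<preceq>\<^sub>R b" "c \<in> S"
  shows "a \<cdot> c \<preceq>\<^sub>R b \<cdot> c"
proof -
  obtain x where x: "x \<in> S" "a \<preceq> b \<cdot> x" "a \<in> S" "b \<in> S"
    using assms(1) unfolding le_R_def by blast
  then have "a \<cdot> c \<preceq> b \<cdot> x \<cdot> c"
    using mono_right assms(2) by (simp add: closed)
  then have "a \<cdot> c \<preceq> b \<cdot> (x \<cdot> c)"
    using x assms(2) by (simp add: assoc)
  then have "a \<cdot> c \<preceq>\<^sub>R b \<cdot> (x \<cdot> c)"
    using x assms(2) by (intro le_R_if_le closed)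
  also have "\<dots> \<preceq>\<^sub>R b \<cdot> c"
    using x assms(2) by (intro le_R_mult_left duo)
  finally show ?thesis .
qed

lemma le_R_square:
  assumes "a \<in> S"
  shows "a \<preceq>\<^sub>R a \<cdot> a"
proof -
  obtain s where s: "s \<in> S" "a \<preceq> a \<cdot> s \<cdot> a"
    using inverse_exists assms by blast
  then have "a \<preceq>\<^sub>R a \<cdot> (s \<cdot> a)"
    using assms by (intro le_R_if_le) (simp_all add: assoc closed)
  also have "\<dots> \<preceq>\<^sub>R a \<cdot> a"
    using assms s by (intro le_R_mult_left duo)
  finally show ?thesis .
qed

text \<open>As bc is also below b and below c, it is their meet for
  \<open>\<preceq>\<^sub>R\<close>. Idempotence, commutativity and completeness of \<R> as a
  semilattice congruence are all instances of this.\<close>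

lemma le_R_mult:
  assumes "a \<preceq>\<^sub>R b" "a \<preceq>\<^sub>R c"
  shows "a \<preceq>\<^sub>R b \<cdot> c"
proof -
  have S: "a \<in> S" "c \<in> S" "b \<in> S"
    using assms unfolding le_R_def by auto
  have "a \<preceq>\<^sub>R a \<cdot> a"
    using S by (intro le_R_square)
  also have "\<dots> \<preceq>\<^sub>R a \<cdot> c"
    using assms S by (intro le_R_mult_left)
  also have "\<dots> \<preceq>\<^sub>R b \<cdot> c"
    using assms S by (intro le_R_mult_right_cong)
  finally show ?thesis .
qed

lemma congruence_green_R: "congruence S (\<cdot>) \<R>"
  unfolding congruence_def
proof (intro conjI ballI equiv_green_R, clarify, intro conjI)
  fix a b c assume "(a, b) \<in> \<R>" "c \<in> S"
  then show "(c \<cdot> a, c \<cdot> b) \<in> \<R>" "(a \<cdot> c, b \<cdot> c) \<in> \<R>"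
    by (auto simp: green_R_iff intro: le_R_mult_left le_R_mult_right_cong)
qed

lemma complete_semilattice_congruence_green_R:
  "complete_semilattice_congruence S (\<cdot>) (\<preceq>) \<R>"
  unfolding complete_semilattice_congruence_def semilattice_congruence_def
  by (intro conjI ballI impI congruence_green_R)
    (simp_all add: green_R_iff le_R_mult le_R_mult_right le_R_refl le_R_if_le duo closed)

lemma right_group_like_green_R_class:
  assumes "T \<in> S // \<R>"
  shows "right_group_like T (\<cdot>) (\<preceq>)"
proof -
  obtain c where c: "c \<in> S" "T = \<R> `` {c}"
    using assms by (rule quotientE)
  have T: "x \<in> T \<longleftrightarrow> c \<preceq>\<^sub>R x \<and> x \<preceq>\<^sub>R c" for x
    using c(2) by (simp add: green_R_iff)
  have TS: "x \<in> S" if "x \<in> T" for x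
    using that T unfolding le_R_def by blast
  show ?thesis
  proof
    show "T \<noteq> {}"
      using c T le_R_refl by blast
    show "a \<cdot> b \<in> T" if "a \<in> T" "b \<in> T" for a b
      using that T le_R_mult[of c a b] le_R_trans[OF le_R_mult_right[of a b]] TS by simp
    have "T \<subseteq> S"
      using TS by blast
    then show "reflp_on T (\<preceq>)" "antisymp_on T (\<preceq>)" "transp_on T (\<preceq>)"
      using refl_le antisym_le trans_le
      by (blast intro: reflp_on_subset antisymp_on_subset transp_on_subset)+
    show "regular T (\<cdot>) (\<preceq>)"
      unfolding regular_def downset_def
    proof
      fix a assume aT: "a \<in> T"
      then have a: "a \<in> S"
        by (rule TS)
      obtain s where s: "s \<in> S" "a \<preceq> a \<cdot> s \<cdot> a" "s \<preceq> s \<cdot> a \<cdot> s"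
        using inverse_exists a by blast
      \<comment> \<open>The inequality for s puts s below a, the one for a puts a below s; so the
        witness s stays in the class of a.\<close>
      have "s \<preceq>\<^sub>R s \<cdot> a \<cdot> s"
        using s a by (intro le_R_if_le closed)
      also have "\<dots> \<preceq>\<^sub>R s \<cdot> a"
        using s a by (intro le_R_mult_right closed)
      also have "\<dots> \<preceq>\<^sub>R a"
        using s a by (intro duo)
      finally have "s \<preceq>\<^sub>R a" .
      have "a \<preceq>\<^sub>R a \<cdot> s \<cdot> a"
        using s a by (intro le_R_if_le closed)
      also have "\<dots> \<preceq>\<^sub>R a \<cdot> s"
        using s a by (intro le_R_mult_right closed)
      also have "\<dots> \<preceq>\<^sub>R s"
        using s a by (intro duo)
      finally have "s \<in> T"
        using \<open>s \<preceq>\<^sub>R a\<close> aT T le_R_trans by blast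
      then show "a \<in> {t \<in> T. \<exists>h\<in>{a \<cdot> s \<cdot> a |s. s \<in> T}. t \<preceq> h}"
        using aT s by blast
    qed
    show "a \<in> downset T (\<preceq>) {b \<cdot> s |s. s \<in> T}" if "a \<in> T" "b \<in> T" for a b
    proof -
      have ab: "a \<in> S" "b \<in> S"
        using that TS by auto
      have "a \<preceq>\<^sub>R b"
        using that T le_R_trans by blast
      \<comment> \<open>The multiplier obtained from b alone may leave the class. Passing to bb
        yields the multiplier bs, which is squeezed between a and b.\<close>
      also have "\<dots> \<preceq>\<^sub>R b \<cdot> b"
        using ab by (intro le_R_square)
      finally obtain s where s: "s \<in> S" "a \<preceq> b \<cdot> (b \<cdot> s)"
        using ab unfolding le_R_def by (auto simp: assoc)
      have "a \<preceq>\<^sub>R b \<cdot> (b \<cdot> s)"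
        using s ab by (intro le_R_if_le closed)
      also have "\<dots> \<preceq>\<^sub>R b \<cdot> s"
        using s ab by (intro duo closed)
      finally have "a \<preceq>\<^sub>R b \<cdot> s" .
      moreover have "b \<cdot> s \<preceq>\<^sub>R b"
        using s ab by (intro le_R_mult_right)
      ultimately have "b \<cdot> s \<in> T"
        using that T le_R_trans by blast
      then show ?thesis
        using that s unfolding downset_def by blast
    qed
  qed (simp_all add: TS assoc mono_left mono_right)
qed

end

section \<open>The inclusion \<L> \<subseteq> \<R> and complete semilattice decompositions\<close>

context regular_ordered_semigroup
begin

lemma right_duo_if_L_subset_R:
  assumes "\<L> \<subseteq> \<R>"
  shows "right_duo_ordered_semigroup S (\<cdot>) (\<preceq>)"
  using le_R_mult_self_if_L_subset_R[OF assms] by unfold_locales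

lemma L_subset_R_if_complete_semilattice:
  assumes "complete_semilattice_of_right_group_like S (\<cdot>) (\<preceq>)"
  shows "\<L> \<subseteq> \<R>"
proof -
  obtain \<rho> where \<rho>: "complete_semilattice_congruence S (\<cdot>) (\<preceq>) \<rho>"
    and classes: "\<And>T. T \<in> S // \<rho> \<Longrightarrow> right_group_like T (\<cdot>) (\<preceq>)"
    using assms unfolding complete_semilattice_of_right_group_like_def by blast
  have eq: "equiv S \<rho>"
    and right: "\<And>a b c. (a, b) \<in> \<rho> \<Longrightarrow> c \<in> S \<Longrightarrow> (a \<cdot> c, b \<cdot> c) \<in> \<rho>"
    and left: "\<And>a b c. (a, b) \<in> \<rho> \<Longrightarrow> c \<in> S \<Longrightarrow> (c \<cdot> a, c \<cdot> b) \<in> \<rho>"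
    and square: "\<And>a. a \<in> S \<Longrightarrow> (a, a \<cdot> a) \<in> \<rho>"
    and comm: "\<And>a b. a \<in> S \<Longrightarrow> b \<in> S \<Longrightarrow> (a \<cdot> b, b \<cdot> a) \<in> \<rho>"
    and complete: "\<And>a b. a \<in> S \<Longrightarrow> b \<in> S \<Longrightarrow> a \<preceq> b \<Longrightarrow> (a, a \<cdot> b) \<in> \<rho>"
    using \<rho> unfolding complete_semilattice_congruence_def semilattice_congruence_def
      congruence_def by auto
  have sym: "(b, a) \<in> \<rho>" if "(a, b) \<in> \<rho>" for a b
    using eq that by (meson equivE symD)
  have tr: "(a, c) \<in> \<rho>" if "(a, b) \<in> \<rho>" "(b, c) \<in> \<rho>" for a b c
    using eq that by (meson equivE transD)
  \<comment> \<open>In the quotient semilattice this says that the class of a is below that of b: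
    completeness gives a \<rho> axb, and b may be squared modulo \<rho>.\<close>
  have absorb: "(a, a \<cdot> b) \<in> \<rho>" if L: "a \<preceq>\<^sub>L b" for a b
  proof -
    obtain x where x: "x \<in> S" "a \<preceq> x \<cdot> b" "a \<in> S" "b \<in> S"
      using L unfolding le_L_def by blast
    have a: "(a, a \<cdot> (x \<cdot> b)) \<in> \<rho>"
      using x by (intro complete closed)
    have "(a \<cdot> x \<cdot> b, a \<cdot> x \<cdot> (b \<cdot> b)) \<in> \<rho>"
      using x by (intro left square closed)
    then have "(a \<cdot> (x \<cdot> b), a \<cdot> (x \<cdot> b) \<cdot> b) \<in> \<rho>"
      using x by (simp add: assoc closed)
    moreover have "(a \<cdot> b, a \<cdot> (x \<cdot> b) \<cdot> b) \<in> \<rho>"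
      using a x by (intro right)
    ultimately show ?thesis
      using a sym tr by blast
  qed
  have le_R: "a \<preceq>\<^sub>R b" if "(a, b) \<in> \<rho>" for a b
  proof -
    have ab: "a \<in> S" "b \<in> S"
      using eq that by (auto simp: equiv_def refl_on_def)
    let ?T = "\<rho> `` {a}"
    have "?T \<in> S // \<rho>"
      using ab by (intro quotientI)
    then interpret T: right_group_like ?T "(\<cdot>)" "(\<preceq>)"
      by (rule classes)
    have "a \<in> ?T" "b \<in> ?T"
      using that sym tr by blast+
    then obtain s where "s \<in> ?T" "a \<preceq> b \<cdot> s"
      using T.right_simple unfolding downset_def by blast
    moreover have "?T \<subseteq> S"
      using eq by (auto simp: equiv_def refl_on_def)
    ultimately show ?thesis
      using ab le_RI by blast
  qed
  show ?thesis
  proof (rule subrelI)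
    fix a b assume "(a, b) \<in> \<L>"
    then have ab: "a \<preceq>\<^sub>L b" "b \<preceq>\<^sub>L a"
      using green_L_iff by auto
    \<comment> \<open>Antisymmetry of the semilattice order: a \<rho> ab \<rho> ba \<rho> b.\<close>
    then have "(a \<cdot> b, b \<cdot> a) \<in> \<rho>"
      by (intro comm) (auto simp: le_L_def)
    then have "(a, b) \<in> \<rho>"
      using absorb[OF ab(1)] absorb[OF ab(2)] sym tr by meson
    then show "(a, b) \<in> \<R>"
      using le_R sym green_R_iff by blast
  qed
qed

end

section \<open>Ordered idempotents in right inverse ordered semigroups\<close>

sublocale right_inverse_ordered_semigroup \<subseteq> regular_ordered_semigroup
  using regular by unfold_locales

context right_inverse_ordered_semigroup
begin

lemma idempotent_L_imp_R:
  assumes "e \<in> S" "f \<in> S" "e \<preceq> e \<cdot> e" "f \<preceq> f \<cdot> f" "(e, f) \<in> \<L>"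
  shows "(e, f) \<in> \<R>"
  using generator_R_unique[of e e f] assms
  by (simp add: ordered_idempotents_def green_L_def)

text \<open>With x an inverse of fe, both h = exf and fh are ordered idempotents generating the same
  left ideal, so fh \<R> h. Then fe is below fh, which is below h, which is below e.\<close>

lemma idempotent_mult_le_R:
  assumes e: "e \<in> S" "e \<preceq> e \<cdot> e" and f: "f \<in> S" "f \<preceq> f \<cdot> f"
  shows "f \<cdot> e \<preceq>\<^sub>R e"
proof -
  obtain x where x: "x \<in> S" "f \<cdot> e \<preceq> f \<cdot> e \<cdot> x \<cdot> (f \<cdot> e)" "x \<preceq> x \<cdot> (f \<cdot> e) \<cdot> x"
    using inverse_exists[OF closed[OF f(1) e(1)]] by blast
  define h where "h = e \<cdot> x \<cdot> f"
  have h: "h \<in> S"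
    unfolding h_def using e f x closed by simp
  have "e \<cdot> x \<cdot> f \<preceq> e \<cdot> (x \<cdot> (f \<cdot> e) \<cdot> x) \<cdot> f"
    using e f x by (intro mult_mono le_refl closed)
  then have hh: "h \<preceq> h \<cdot> h"
    unfolding h_def using e f x by (simp add: assoc closed)
  have "f \<cdot> h \<preceq> f \<cdot> (h \<cdot> h)"
    using hh h f by (intro mono_left closed)
  also have "h \<cdot> h = e \<cdot> x \<cdot> f \<cdot> h"
    unfolding h_def by simp
  finally have "f \<cdot> h \<preceq> f \<cdot> (e \<cdot> x \<cdot> f \<cdot> h)" .
  \<comment> \<open>Doubling the inner f lets one copy end the first factor fh = fexf and the other
    begin the second.\<close>
  moreover have "f \<cdot> (e \<cdot> x \<cdot> f \<cdot> h) \<preceq> f \<cdot> (e \<cdot> x \<cdot> (f \<cdot> f) \<cdot> h)"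
    using e f x h by (intro mult_mono le_refl closed)
  ultimately have "f \<cdot> h \<preceq> f \<cdot> (e \<cdot> x \<cdot> (f \<cdot> f) \<cdot> h)"
    by (rule le_trans) (use e f x h closed in auto)
  then have fh: "f \<cdot> h \<preceq> (f \<cdot> h) \<cdot> (f \<cdot> h)"
    unfolding h_def using e f x by (simp add: assoc closed)
  have "h \<preceq> (e \<cdot> x) \<cdot> (f \<cdot> h)"
    using hh e f x h unfolding h_def by (simp add: assoc closed)
  then have "h \<preceq>\<^sub>L f \<cdot> h"
    by (rule le_LI) (use e f x h in \<open>simp_all add: closed\<close>)
  then have "(f \<cdot> h, h) \<in> \<L>"
    using le_L_mult_left h f by (simp add: green_L_iff)
  then have "(f \<cdot> h, h) \<in> \<R>"
    using f h hh fh by (intro idempotent_L_imp_R closed)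
  then have fhR: "f \<cdot> h \<preceq>\<^sub>R h"
    by (simp add: green_R_iff)
  have "f \<cdot> e \<preceq> (f \<cdot> h) \<cdot> e"
    using x(2) e f x(1) unfolding h_def by (simp add: assoc closed)
  then have "f \<cdot> e \<preceq>\<^sub>R f \<cdot> h"
    by (rule le_RI) (use e f h in \<open>simp_all add: closed\<close>)
  also note fhR
  also have "h \<preceq>\<^sub>R e"
    unfolding h_def using le_R_mult_right[of e "x \<cdot> f"] e f x by (simp add: assoc closed)
  finally show ?thesis .
qed

lemma L_subset_R_if_congruence:
  assumes "congruence S (\<cdot>) \<R>"
  shows "\<L> \<subseteq> \<R>"
proof -
  have right: "a \<cdot> c \<preceq>\<^sub>R b \<cdot> c" if "(a, b) \<in> \<R>" "c \<in> S" for a b c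
    using assms that green_R_iff unfolding congruence_def by blast
  \<comment> \<open>Since as \<R> a, the congruence property allows as to be replaced by a in the
    bound asa.\<close>
  have square: "a \<preceq>\<^sub>R a \<cdot> a" if a: "a \<in> S" for a
  proof -
    obtain s where s: "s \<in> S" "a \<preceq> a \<cdot> s \<cdot> a"
      using inverse_exists a by blast
    have "a \<preceq> (a \<cdot> s) \<cdot> a"
      using s by simp
    then have "a \<preceq>\<^sub>R a \<cdot> s"
      by (rule le_RI) (use a s in \<open>simp_all add: closed\<close>)
    then have R: "(a \<cdot> s, a) \<in> \<R>"
      using a s le_R_mult_right by (simp add: green_R_iff)
    have "a \<preceq>\<^sub>R a \<cdot> s \<cdot> a"
      using a s by (intro le_R_if_le closed)
    also have "\<dots> \<preceq>\<^sub>R a \<cdot> a"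
      using R a by (rule right)
    finally show ?thesis .
  qed
  \<comment> \<open>Squaring a inside sa and appending s produces (sa)(as), a product of two ordered
    idempotents. The hypotheses are symmetric in a and s, so the reverse comparison comes with
    it.\<close>
  have twisted: "s \<cdot> a \<preceq>\<^sub>R a \<cdot> s"
    if as: "a \<in> S" "s \<in> S" "a \<preceq> a \<cdot> s \<cdot> a" "s \<preceq> s \<cdot> a \<cdot> s" for a s
  proof -
    have "a \<cdot> s \<preceq> (a \<cdot> s \<cdot> a) \<cdot> s" "s \<cdot> a \<preceq> (s \<cdot> a \<cdot> s) \<cdot> a"
      using as closed by (auto intro: mono_right)
    then have E: "a \<cdot> s \<preceq> (a \<cdot> s) \<cdot> (a \<cdot> s)" "s \<cdot> a \<preceq> (s \<cdot> a) \<cdot> (s \<cdot> a)"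
      using as by (simp_all add: assoc closed)
    have "a \<preceq>\<^sub>R a \<cdot> s"
      using as by (intro le_RI[of a "a \<cdot> s" a] closed)
    have "s \<cdot> a \<preceq>\<^sub>R s \<cdot> (a \<cdot> a)"
      using as square by (intro le_R_mult_left)
    also have "\<dots> \<preceq>\<^sub>R s \<cdot> (a \<cdot> (a \<cdot> s))"
      using \<open>a \<preceq>\<^sub>R a \<cdot> s\<close> as by (intro le_R_mult_left)
    also have "\<dots> = (s \<cdot> a) \<cdot> (a \<cdot> s)"
      using as by (simp add: assoc closed)
    also have "\<dots> \<preceq>\<^sub>R a \<cdot> s"
      using as E by (intro idempotent_mult_le_R closed)
    finally show ?thesis .
  qed
  have idem: "\<exists>e\<in>S. e \<preceq> e \<cdot> e \<and> (a, e) \<in> \<L> \<and> (a, e) \<in> \<R>" if a: "a \<in> S" for a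
  proof -
    obtain s where s: "s \<in> S" "a \<preceq> a \<cdot> s \<cdot> a" "s \<preceq> s \<cdot> a \<cdot> s"
      using inverse_exists a by blast
    have sa: "s \<cdot> a \<in> S"
      using a s closed by simp
    have "s \<cdot> a \<preceq> (s \<cdot> a \<cdot> s) \<cdot> a"
      using a s by (intro mono_right closed)
    then have "s \<cdot> a \<preceq> (s \<cdot> a) \<cdot> (s \<cdot> a)"
      using a s by (simp add: assoc closed)
    moreover have "a \<preceq> a \<cdot> (s \<cdot> a)"
      using a s by (simp add: assoc)
    then have "a \<preceq>\<^sub>L s \<cdot> a"
      by (rule le_LI) (use a sa in simp_all)
    then have "(a, s \<cdot> a) \<in> \<L>"
      using a s le_L_mult_left by (simp add: green_L_iff)
    moreover have "(a, s \<cdot> a) \<in> \<R>"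
    proof -
      have "a \<preceq>\<^sub>R a \<cdot> s"
        using a s by (intro le_RI[of a "a \<cdot> s" a] closed)
      also have "\<dots> \<preceq>\<^sub>R s \<cdot> a"
        using a s by (intro twisted)
      finally have "a \<preceq>\<^sub>R s \<cdot> a" .
      moreover have "s \<cdot> a \<preceq>\<^sub>R a \<cdot> s"
        using a s by (intro twisted)
      then have "s \<cdot> a \<preceq>\<^sub>R a"
        using a s le_R_mult_right le_R_trans by blast
      ultimately show ?thesis
        by (simp add: green_R_iff)
    qed
    ultimately show ?thesis
      using sa by blast
  qed
  show ?thesis
  proof (rule subrelI)
    fix a b assume L: "(a, b) \<in> \<L>"
    then have "a \<in> S" "b \<in> S"
      by (auto simp: green_L_def)
    then obtain e f where e: "e \<in> S" "e \<preceq> e \<cdot> e" "(a, e) \<in> \<L>" "(a, e) \<in> \<R>"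
      and f: "f \<in> S" "f \<preceq> f \<cdot> f" "(b, f) \<in> \<L>" "(b, f) \<in> \<R>"
      using idem by meson
    have "(e, f) \<in> \<L>"
      using L e f by (auto simp: green_L_def)
    then have "(e, f) \<in> \<R>"
      using e f by (intro idempotent_L_imp_R)
    then show "(a, b) \<in> \<R>"
      using e f by (auto simp: green_R_def)
  qed
qed

end

theorem theorem3p13:
  fixes S :: "'a set"
    and mult :: "'a \<Rightarrow> 'a \<Rightarrow> 'a"
    and le :: "'a \<Rightarrow> 'a \<Rightarrow> bool"
  assumes "right_inverse_ordered_semigroup S mult le"
    and "\<not> has_zero S mult le"
  shows "(congruence S mult (green_R S mult le) \<longleftrightarrow> green_L S mult le = green_H S mult le) \<and>
         (green_L S mult le = green_H S mult le \<longleftrightarrow>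
            complete_semilattice_of_right_group_like S mult le)"
proof -
  interpret right_inverse_ordered_semigroup S mult le
    by (rule assms(1))
  \<comment> \<open>The inclusion \<L> \<subseteq> \<R>, which is what \<L> = \<H> amounts to,
    serves as the hub: it implies the other two conditions, and each of them implies it.\<close>
  have "congruence S mult \<R>" "complete_semilattice_of_right_group_like S mult le"
    if "\<L> \<subseteq> \<R>"
  proof -
    interpret right_duo_ordered_semigroup S mult le
      using that by (rule right_duo_if_L_subset_R)
    show "congruence S mult \<R>"
      by (rule congruence_green_R)
    show "complete_semilattice_of_right_group_like S mult le"
      unfolding complete_semilattice_of_right_group_like_def
      using complete_semilattice_congruence_green_R right_group_like_green_R_class by blast
  qed
  then show ?thesis
    using L_subset_R_if_congruence L_subset_R_if_complete_semilattice green_L_eq_green_H_iff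
    by blast
qed

end
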